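(* Let $K$ be the field of fractions of a Dedekind domain $R$, and fix a complete set $A$ of non-archimedean absolute values on $K$. Let $\phi \in K(z)$ have degree $d \geq 2$, and let $p,q \in R[z]$ be relatively prime polynomials with $\phi = p/q$. Let $p_n$ and $q_n$ ($n\ge1$) be the numerators and denominators of the iterates $\phi^n$ determined by the choice of $p,q$ (as defined in the context), and let $S \subseteq A$ be the set of absolute values at which either $\phi$ has bad reduction or the pair $p,q$ is not normalized. Assume that $$p'(0) = q'(0) = 0.$$ Then the sequence $(p_n(0))_{n\geq 1}$ is an $S$-rigid divisibility sequence.
   Context: A complete set of non-archimedean absolute values on $K$ is a set containing exactly one choice from each equivalence class of non-archimedean absolute values. Iterates: let $P(Z,W)=W^dp(Z/W)$ and $Q(Z,W)=W^dq(Z/W)$ be the degree-$d$ homogenizations of $p$ and $q$, where $d=\max\{\deg p,\deg q\}$. Set $p_1=p$, $q_1=q$, and for $n\ge2$, $p_n=P(p_{n-1},q_{n-1})$, $q_n=Q(p_{n-1},q_{n-1})$, so that $\phi^n=p_n/q_n$. Normalized: a pair $p,q$ (equivalently $P,Q$) is normalized with respect to a non-archimedean absolute value $|\cdot|$ if all coefficients of $p$ and $q$ have absolute value at most $1$ and at least one coefficient of $p$ or $q$ has absolute value $1$. Reduction: choose a normalized pair $P^*,Q^*$ of degree-$d$ homogeneous polynomials with $\phi=[P^*,Q^*]$; $\phi$ has good reduction at $|\cdot|$ if the coefficient-wise reductions $\widetilde{P^*},\widetilde{Q^*}$ over the residue field $k$ have no common roots in $\mathbb{P}^1(\overline k)$.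 Otherwise $\phi$ has bad reduction at $|\cdot|$. (This does not depend on the normalized pair chosen.) $S$-rigid divisibility: let $(c_i)_{i\ge1}$ be a sequence in $K$ and let $S\subseteq A$ be finite. The sequence $(c_i)_{i\ge1}$ is an $S$-rigid divisibility sequence if for all $|\cdot|\in A\setminus S$ the following hold: (1) if $|c_n|<1$, then $|c_n|=|c_{kn}|$ for all $k\ge1$; (2) if $|c_m|<1$ and $|c_n|<1$, then $|c_{\gcd(m,n)}|<1$.
   Formalization: S-rigid divisibility is defined for finite S, but the set S here can be infinite (e.g. K=Q(t), R=Q[t], p=z^2+1/2, q=1); conditions (1) and (2) are therefore stated for all absolute values in A outside S, whether or not S is finite, and finiteness of S is not asserted. *)

theory Defs
  imports
    Complex_Main
    "HOL-Computational_Algebra.Computational_Algebra"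
    "HOL-Algebra.Algebraic_Closure_Type"
begin

text \<open>
  The field \<open>K\<close> is a type \<open>'a :: field\<close>, \<open>K[z]\<close> is \<open>'a poly\<close> and \<open>K(z)\<close> is
  \<open>'a poly fract\<close>. Subrings of \<open>K\<close> are passed to the locales of \<open>HOL-Algebra\<close> by restricting
  the carrier of \<^const>\<open>ring_of_type_algebra\<close>. Some names (\<open>degree\<close>, \<open>coeff\<close>) are also used by
  \<open>HOL-Algebra\<close>, hence the qualified \<open>Polynomial.degree\<close> and \<open>Polynomial.coeff\<close>.
\<close>

section \<open>Dedekind domains\<close>

definition restricted_ring :: "'a::field set \<Rightarrow> 'a ring"
  where "restricted_ring R = ring_of_type_algebra\<lparr>carrier := R\<rparr>"

definition integral_over :: "'a::field set \<Rightarrow> 'a \<Rightarrow> bool"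
  where "integral_over R x \<longleftrightarrow>
    (\<exists>f :: 'a poly. Polynomial.lead_coeff f = 1 \<and>
       (\<forall>i. Polynomial.coeff f i \<in> R) \<and> poly f x = 0)"

text \<open>
  Noetherian, integrally closed in the field of fractions \<open>{a / b}\<close> (formed inside \<open>K\<close>), and all
  nonzero primes maximal. Fields are not excluded.
\<close>

definition dedekind_domain :: "'a::field set \<Rightarrow> bool"
  where "dedekind_domain R \<longleftrightarrow>
    subring R ring_of_type_algebra \<and>
    noetherian_domain (restricted_ring R) \<and>
    (\<forall>a\<in>R. \<forall>b\<in>R. b \<noteq> 0 \<longrightarrow> integral_over R (a / b) \<longrightarrow> a / b \<in> R) \<and>
    (\<forall>I. primeideal I (restricted_ring R) \<longrightarrow> I \<noteq> {0} \<longrightarrow> maximalideal I (restricted_ring R))"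

definition is_fraction_field_of :: "'a::field set \<Rightarrow> bool"
  where "is_fraction_field_of R \<longleftrightarrow> (\<forall>x::'a. \<exists>a\<in>R. \<exists>b\<in>R. b \<noteq> 0 \<and> x = a / b)"


section \<open>Non-archimedean absolute values\<close>

text \<open>The trivial absolute value is included.\<close>

definition nonarch_absval :: "('a::field \<Rightarrow> real) \<Rightarrow> bool"
  where "nonarch_absval v \<longleftrightarrow>
    (\<forall>x. 0 \<le> v x) \<and> (\<forall>x. v x = 0 \<longleftrightarrow> x = 0) \<and>
    (\<forall>x y. v (x * y) = v x * v y) \<and> (\<forall>x y. v (x + y) \<le> max (v x) (v y))"

definition absval_equiv :: "('a::field \<Rightarrow> real) \<Rightarrow> ('a \<Rightarrow> real) \<Rightarrow> bool"
  where "absval_equiv v w \<longleftrightarrow> (\<exists>s>0. \<forall>x. w x = v x powr s)"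

definition complete_absvals :: "('a::field \<Rightarrow> real) set \<Rightarrow> bool"
  where "complete_absvals A \<longleftrightarrow>
    (\<forall>v\<in>A. nonarch_absval v) \<and>
    (\<forall>v. nonarch_absval v \<longrightarrow> (\<exists>!w. w \<in> A \<and> absval_equiv v w))"

definition valuation_ideal :: "('a::field \<Rightarrow> real) \<Rightarrow> 'a set"
  where "valuation_ideal v = {x. v x < 1}"

definition valuation_ring :: "('a::field \<Rightarrow> real) \<Rightarrow> 'a ring"
  where "valuation_ring v = restricted_ring {x. v x \<le> 1}"

definition residue_field :: "('a::field \<Rightarrow> real) \<Rightarrow> 'a set ring"
  where "residue_field v = valuation_ring v Quot valuation_ideal v"

definition reduce :: "('a::field \<Rightarrow> real) \<Rightarrow> 'a \<Rightarrow> 'a set"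
  where "reduce v x = valuation_ideal v +>\<^bsub>valuation_ring v\<^esub> x"


section \<open>Rational functions and their iterates\<close>

definition rat_degree :: "'a::field poly fract \<Rightarrow> nat"
  where "rat_degree \<phi> = (THE d. \<exists>p q. q \<noteq> 0 \<and> coprime p q \<and> \<phi> = Fraction_Field.Fract p q \<and>
    d = max (Polynomial.degree p) (Polynomial.degree q))"

text \<open>
  For \<open>Polynomial.degree p \<le> d\<close> this is \<open>P(Z,W)\<close> where \<open>P(Z,W) = W^d p(Z/W)\<close>, evaluated at
  polynomials \<open>Z\<close> and \<open>W\<close>.
\<close>

definition homog_eval :: "nat \<Rightarrow> 'a::field poly \<Rightarrow> 'a poly \<Rightarrow> 'a poly \<Rightarrow> 'a poly"
  where "homog_eval d p Z W =
    (\<Sum>i\<le>d. Polynomial.smult (Polynomial.coeff p i) (Z ^ i * W ^ (d - i)))"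

text \<open>
  The pair \<open>(p\<^sub>n, q\<^sub>n)\<close> for \<open>n \<ge> 1\<close>; the value at \<open>0\<close> (the identity map) is never used.
\<close>

fun iterate_pair :: "'a::field poly \<Rightarrow> 'a poly \<Rightarrow> nat \<Rightarrow> 'a poly \<times> 'a poly"
  where
    "iterate_pair p q 0 = ([:0, 1:], 1)"
  | "iterate_pair p q (Suc 0) = (p, q)"
  | "iterate_pair p q (Suc (Suc n)) =
      (let d = max (Polynomial.degree p) (Polynomial.degree q);
           (a, b) = iterate_pair p q (Suc n)
       in (homog_eval d p a b, homog_eval d q a b))"

definition iterate_num :: "'a::field poly \<Rightarrow> 'a poly \<Rightarrow> nat \<Rightarrow> 'a poly"
  where "iterate_num p q n = fst (iterate_pair p q n)"


section \<open>Normalized pairs and good reduction\<close>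

definition normalized_pair :: "('a::field \<Rightarrow> real) \<Rightarrow> 'a poly \<Rightarrow> 'a poly \<Rightarrow> bool"
  where "normalized_pair v p q \<longleftrightarrow>
    (\<forall>i. v (Polynomial.coeff p i) \<le> 1 \<and> v (Polynomial.coeff q i) \<le> 1) \<and>
    (\<exists>i. v (Polynomial.coeff p i) = 1 \<or> v (Polynomial.coeff q i) = 1)"

text \<open>
  A form \<open>P(Z,W)\<close> of degree \<open>d\<close> over \<open>K\<close> is represented by the polynomial \<open>P(z,1)\<close> of degree at
  most \<open>d\<close>, with the same coefficients. The next definition is the value of the coefficient-wise
  reduction of such a form at a point with coordinates in the algebraic closure of the residue
  field \<open>k\<close>, into which \<open>k\<close> is embedded by \<^const>\<open>ring.indexed_const\<close>.
\<close>

definition reduced_form_eval ::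
    "('a::field \<Rightarrow> real) \<Rightarrow> nat \<Rightarrow> 'a poly \<Rightarrow>
     (('a set list \<times> nat) multiset \<Rightarrow> 'a set) \<Rightarrow> (('a set list \<times> nat) multiset \<Rightarrow> 'a set) \<Rightarrow>
     (('a set list \<times> nat) multiset \<Rightarrow> 'a set)"
  where "reduced_form_eval v d P Z W =
    (let k = residue_field v; L = field.alg_closure k
     in \<Oplus>\<^bsub>L\<^esub>i\<in>{..d}. ring.indexed_const k (reduce v (Polynomial.coeff P i))
          \<otimes>\<^bsub>L\<^esub> (Z [^]\<^bsub>L\<^esub> i \<otimes>\<^bsub>L\<^esub> W [^]\<^bsub>L\<^esub> (d - i)))"

text \<open>Points of the projective line are given by homogeneous coordinates \<open>(Z, W) \<noteq> (0, 0)\<close>.\<close>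

definition reductions_have_common_root ::
    "('a::field \<Rightarrow> real) \<Rightarrow> nat \<Rightarrow> 'a poly \<Rightarrow> 'a poly \<Rightarrow> bool"
  where "reductions_have_common_root v d P Q \<longleftrightarrow>
    (let L = field.alg_closure (residue_field v)
     in \<exists>Z\<in>carrier L. \<exists>W\<in>carrier L. (Z, W) \<noteq> (\<zero>\<^bsub>L\<^esub>, \<zero>\<^bsub>L\<^esub>) \<and>
          reduced_form_eval v d P Z W = \<zero>\<^bsub>L\<^esub> \<and> reduced_form_eval v d Q Z W = \<zero>\<^bsub>L\<^esub>)"

definition good_reduction :: "('a::field \<Rightarrow> real) \<Rightarrow> 'a poly fract \<Rightarrow> bool"
  where "good_reduction v \<phi> \<longleftrightarrow>
    (\<exists>P Q. Polynomial.degree P \<le> rat_degree \<phi> \<and> Polynomial.degree Q \<le> rat_degree \<phi> \<and>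
       Q \<noteq> 0 \<and> \<phi> = Fraction_Field.Fract P Q \<and> normalized_pair v P Q \<and>
       \<not> reductions_have_common_root v (rat_degree \<phi>) P Q)"


section \<open>Rigid divisibility\<close>

text \<open>
  Finiteness of \<open>S\<close> is not part of the predicate, which therefore makes sense for any set \<open>S\<close> of
  exceptional absolute values. Since all non-archimedean absolute values of \<open>K\<close> are considered,
  the set of those at which \<open>\<phi>\<close> has bad reduction or \<open>p, q\<close> is not normalized may be infinite:
  for \<open>K\<close> the rational functions in \<open>t\<close> over the rationals, \<open>p = z^2 + 1/2\<close> and \<open>q = 1\<close>, it
  contains (up to equivalence) the 2-adic Gauss norms with \<open>|t| = r\<close> for every real \<open>r > 0\<close>,
  which are pairwise inequivalent.
\<close>

definition rigid_divisibility_seq ::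
    "('a::field \<Rightarrow> real) set \<Rightarrow> ('a \<Rightarrow> real) set \<Rightarrow> (nat \<Rightarrow> 'a) \<Rightarrow> bool"
  where "rigid_divisibility_seq A S c \<longleftrightarrow>
    (\<forall>v\<in>A - S.
      (\<forall>n\<ge>1. v (c n) < 1 \<longrightarrow> (\<forall>k\<ge>1. v (c n) = v (c (k * n)))) \<and>
      (\<forall>m\<ge>1. \<forall>n\<ge>1. v (c m) < 1 \<longrightarrow> v (c n) < 1 \<longrightarrow> v (c (gcd m n)) < 1))"

end

theory Submission
  imports Defs
begin

text \<open>
  Write \<open>F(x, y) = (P(x, y), Q(x, y))\<close> for the homogeneous lift of \<open>\<phi>\<close> to the plane. The values
  \<open>(p\<^sub>n(0), q\<^sub>n(0))\<close> are the orbit \<open>F\<^sup>n(0, 1) = (a\<^sub>n, b\<^sub>n)\<close> of a single vector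
  (\<open>poly_iterate_pair\<close>), so the theorem is about this orbit at one absolute value \<open>v\<close> outside \<open>S\<close>.

  Two facts drive the proof. Good reduction makes \<open>F\<close> preserve the vectors with
  \<open>max |x| |y| = 1\<close> (\<open>primitive_form_map\<close>): if both coordinates of \<open>F(x, y)\<close> had absolute value
  less than \<open>1\<close>, then the reduction of \<open>(x, y)\<close> would be a common root of the reduced forms. Hence
  \<open>|b\<^sub>n| = 1\<close> whenever \<open>|a\<^sub>n| < 1\<close>. On the other hand \<open>p'(0) = q'(0) = 0\<close> says that no term of
  \<open>P\<close> or \<open>Q\<close> is linear in the first variable, so \<open>F(x, y)\<close> and \<open>F(0, y)\<close> agree up to an error of
  size \<open>|x|\<^sup>2\<close>, and further applications of \<open>F\<close>, whose coefficients are integral, do not enlarge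
  this error (\<open>form_map_pow_diff_le_square\<close>).

  As \<open>F\<^sup>m(0, b) = b\<^bsup>d^m\<^esup> F\<^sup>m(0, 1)\<close> by homogeneity, the two facts give
  \<open>|a\<^bsub>n+m\<^esub> - u a\<^sub>m| \<le> |a\<^sub>n|\<^sup>2\<close> with \<open>|u| = 1\<close> whenever \<open>|a\<^sub>n| < 1\<close>
  (\<open>form_map_orbit_congruence\<close>). This implies rigid divisibility (\<open>rigid_of_congruence\<close>). Taking
  for \<open>m\<close> a multiple of \<open>n\<close>, the error \<open>|a\<^sub>n|\<^sup>2\<close> is too small to change an absolute value equal to
  \<open>|a\<^sub>n|\<close>; and since \<open>|a\<^sub>n| < 1\<close> and \<open>|a\<^bsub>n+m\<^esub>| < 1\<close> force \<open>|a\<^sub>m| < 1\<close>, Euclid's algorithm by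
  repeated subtraction carries \<open>|a\<^sub>m| < 1\<close> and \<open>|a\<^sub>n| < 1\<close> down to \<open>gcd m n\<close>.
\<close>
section \<open>Homogeneous forms and iteration\<close>

text \<open>
  A form is given by its dehomogenization and its degree, so that a form divisible by the second
  variable is represented as well.
\<close>
definition form_eval :: "nat \<Rightarrow> 'a::comm_semiring_1 poly \<Rightarrow> 'a \<Rightarrow> 'a \<Rightarrow> 'a"
  where "form_eval d p x y = (\<Sum>i\<le>d. Polynomial.coeff p i * (x ^ i * y ^ (d - i)))"

definition form_map :: "nat \<Rightarrow> 'a::comm_semiring_1 poly \<Rightarrow> 'a poly \<Rightarrow> 'a \<times> 'a \<Rightarrow> 'a \<times> 'a"
  where "form_map d p q z = (form_eval d p (fst z) (snd z), form_eval d q (fst z) (snd z))"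

lemma form_map_sel:
  "fst (form_map d p q z) = form_eval d p (fst z) (snd z)"
  "snd (form_map d p q z) = form_eval d q (fst z) (snd z)"
  by (simp_all add: form_map_def)

lemma form_eval_scale: "form_eval d p (c * x) (c * y) = c ^ d * form_eval d p x y"
proof -
  have "Polynomial.coeff p i * ((c * x) ^ i * (c * y) ^ (d - i)) =
      c ^ d * (Polynomial.coeff p i * (x ^ i * y ^ (d - i)))" if "i \<le> d" for i
  proof -
    have "c ^ d = c ^ i * c ^ (d - i)"
      using that by (simp flip: power_add)
    then show ?thesis
      by (simp add: power_mult_distrib mult_ac)
  qed
  then show ?thesis
    unfolding form_eval_def sum_distrib_left by (intro sum.cong) auto
qed

lemma form_eval_smult: "form_eval d (Polynomial.smult c p) x y = c * form_eval d p x y"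
  by (simp add: form_eval_def sum_distrib_left mult_ac)

lemma form_eval_one_right:
  assumes "Polynomial.degree p \<le> d"
  shows "form_eval d p x 1 = poly p x"
proof -
  have "poly p x = (\<Sum>i\<le>d. Polynomial.coeff p i * x ^ i)"
    unfolding poly_altdef using assms
    by (intro sum.mono_neutral_left) (auto simp: not_le coeff_eq_0)
  then show ?thesis
    by (simp add: form_eval_def)
qed

lemma poly_homog_eval: "poly (homog_eval d p Z W) x = form_eval d p (poly Z x) (poly W x)"
  by (simp add: homog_eval_def form_eval_def poly_sum)

lemma form_map_pow_scale:
  "(form_map d p q ^^ m) (c * x, c * y) =
     (c ^ d ^ m * fst ((form_map d p q ^^ m) (x, y)), c ^ d ^ m * snd ((form_map d p q ^^ m) (x, y)))"
proof (induction m)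
  case (Suc m)
  then show ?case
    by (simp add: prod_eq_iff form_map_sel form_eval_scale power_mult mult.commute[of d])
qed simp

text \<open>
  The formula already holds for \<open>n = 0\<close>, where the pair is \<open>(z, 1)\<close>; this makes the base case of
  the recursion, \<open>(p, q)\<close>, one more application of the lift.
\<close>
lemma poly_iterate_pair:
  fixes p q :: "'a::field poly" and x :: 'a
  defines "d \<equiv> max (Polynomial.degree p) (Polynomial.degree q)"
  shows "(poly (fst (iterate_pair p q n)) x, poly (snd (iterate_pair p q n)) x) =
    (form_map d p q ^^ n) (x, 1)"
proof (induction n)
  case 0
  show ?case by simp
next
  case (Suc n)
  show ?case
  proof (cases n)
    case 0
    then show ?thesis
      by (simp add: prod_eq_iff form_map_sel form_eval_one_right d_def)
  next
    case (Suc k)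
    then have "iterate_pair p q (Suc n) =
        (homog_eval d p (fst (iterate_pair p q n)) (snd (iterate_pair p q n)),
         homog_eval d q (fst (iterate_pair p q n)) (snd (iterate_pair p q n)))"
      by (simp add: d_def Let_def split_beta)
    then show ?thesis
      by (simp add: prod_eq_iff poly_homog_eval form_map_sel flip: Suc.IH)
  qed
qed

section \<open>Lowest terms\<close>

text \<open>
  Bezout's identity by Euclid's algorithm, for an arbitrary Euclidean ring, where the greatest common
  divisor is defined only up to a unit.
\<close>
lemma exists_linear_combination_dvd:
  fixes a b :: "'a::{euclidean_ring}"
  shows "\<exists>u v. u * a + v * b dvd a \<and> u * a + v * b dvd b"
proof (induction "euclidean_size b" arbitrary: a b rule: less_induct)
  case less
  show ?case
  proof (cases "b = 0")
    case True
    then show ?thesis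
      by (intro exI[of _ 1] exI[of _ 0]) simp
  next
    case False
    then obtain u v where uv: "u * b + v * (a mod b) dvd b" "u * b + v * (a mod b) dvd a mod b"
      using less[of "a mod b" b] mod_size_less by blast
    have "u * b + v * (a mod b) = v * a + (u - v * (a div b)) * b"
      by (simp add: algebra_simps minus_div_mult_eq_mod[symmetric])
    moreover have "u * b + v * (a mod b) dvd a"
      using uv dvd_mod_iff by blast
    ultimately show ?thesis
      using uv(1) by metis
  qed
qed

lemma coprime_dvd_mult_cancel:
  fixes a b c :: "'a::field poly"
  assumes "coprime a b" "a dvd b * c"
  shows "a dvd c"
proof -
  obtain u v where "u * a + v * b dvd a" "u * a + v * b dvd b"
    using exists_linear_combination_dvd by blast
  then have "u * a + v * b dvd 1"
    using assms(1) coprime_common_divisor by blast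
  then obtain w where "1 = (u * a + v * b) * w" ..
  then have "c = (u * a + v * b) * w * c"
    by simp
  also have "\<dots> = a * (u * w * c) + (b * c) * (v * w)"
    by (simp add: algebra_simps)
  finally show ?thesis
    using assms(2) by (metis dvd_add dvd_triv_left dvd_mult2)
qed

text \<open>
  Good reduction is witnessed by an arbitrary pair representing \<open>\<phi>\<close>; this relates it to a coprime
  pair.
\<close>
lemma Fract_eq_lowest_terms:
  fixes p q P Q :: "'a::field poly"
  assumes "q \<noteq> 0" "Q \<noteq> 0" "coprime p q" "Fraction_Field.Fract P Q = Fraction_Field.Fract p q"
  obtains h where "h \<noteq> 0" "P = p * h" "Q = q * h"
proof -
  have eq: "P * q = p * Q"
    using assms eq_fract(1)[of Q q P p] by simp
  then have "q dvd p * Q"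
    by (metis dvd_triv_right)
  then obtain h where h: "Q = q * h"
    using coprime_dvd_mult_cancel[of q p Q] assms(3) by (auto simp: coprime_commute elim: dvdE)
  then have "P = p * h"
    using eq assms(1) by simp
  with h assms(2) show ?thesis
    by (intro that[of h]) auto
qed

lemma max_degree_mult_right:
  fixes p q h :: "'a::field poly"
  assumes "q \<noteq> 0" "h \<noteq> 0"
  shows "max (Polynomial.degree (p * h)) (Polynomial.degree (q * h)) =
    max (Polynomial.degree p) (Polynomial.degree q) + Polynomial.degree h"
  using assms by (cases "p = 0") (auto simp: degree_mult_eq)

lemma rat_degree_eq:
  fixes p q :: "'a::field poly"
  assumes "q \<noteq> 0" "coprime p q"
  shows "rat_degree (Fraction_Field.Fract p q) = max (Polynomial.degree p) (Polynomial.degree q)"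
  unfolding rat_degree_def
proof (rule the_equality)
  show "\<exists>p' q'. q' \<noteq> 0 \<and> coprime p' q' \<and> Fraction_Field.Fract p q = Fraction_Field.Fract p' q' \<and>
      max (Polynomial.degree p) (Polynomial.degree q) = max (Polynomial.degree p') (Polynomial.degree q')"
    using assms by blast
next
  fix d
  assume "\<exists>p' q'. q' \<noteq> 0 \<and> coprime p' q' \<and> Fraction_Field.Fract p q = Fraction_Field.Fract p' q' \<and>
      d = max (Polynomial.degree p') (Polynomial.degree q')"
  then obtain p' q' where *: "q' \<noteq> 0" "coprime p' q'"
      "Fraction_Field.Fract p q = Fraction_Field.Fract p' q'"
      "d = max (Polynomial.degree p') (Polynomial.degree q')"
    by blast
  obtain h where h: "h \<noteq> 0" "p' = p * h" "q' = q * h"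
    using Fract_eq_lowest_terms[OF assms(1) *(1) assms(2)] *(3) by metis
  have "h dvd 1"
    using *(2) coprime_common_divisor[of p' q' h] h by simp
  then show "d = max (Polynomial.degree p) (Polynomial.degree q)"
    using h assms(1) *(4) by (simp add: max_degree_mult_right is_unit_iff_degree)
qed

section \<open>Non-archimedean estimates\<close>

context
  fixes v :: "'a::field \<Rightarrow> real"
  assumes v: "nonarch_absval v"
begin

lemma absval_nonneg: "0 \<le> v x"
  and absval_eq_0_iff: "v x = 0 \<longleftrightarrow> x = 0"
  and absval_mult: "v (x * y) = v x * v y"
  and absval_add_le: "v (x + y) \<le> max (v x) (v y)"
  using v by (auto simp: nonarch_absval_def)

lemma absval_0: "v 0 = 0"
  by (simp add: absval_eq_0_iff)

lemma absval_1: "v 1 = 1"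
proof -
  have "v 1 * v 1 = v 1"
    by (simp flip: absval_mult)
  moreover have "v 1 \<noteq> 0"
    by (simp add: absval_eq_0_iff)
  ultimately show ?thesis by simp
qed

lemma absval_power: "v (x ^ n) = v x ^ n"
  by (induction n) (auto simp: absval_1 absval_mult)

lemma absval_minus: "v (- x) = v x"
proof -
  have "v (- 1) ^ 2 = 1 ^ 2"
    by (simp add: absval_1 flip: absval_power)
  then have "v (- 1) = 1"
    using absval_nonneg by (simp only: power2_eq_iff_nonneg zero_le_one)
  then show ?thesis
    using absval_mult[of "- 1" x] by simp
qed

lemma absval_diff_le: "v (x - y) \<le> max (v x) (v y)"
  using absval_add_le[of x "- y"] by (simp add: absval_minus)

lemma absval_add_le_bound: "v x \<le> r \<Longrightarrow> v y \<le> r \<Longrightarrow> v (x + y) \<le> r"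
  using absval_add_le[of x y] by linarith

lemma absval_sum_le:
  assumes "0 \<le> r" "\<And>i. i \<in> I \<Longrightarrow> v (f i) \<le> r"
  shows "v (sum f I) \<le> r"
  using assms(2)
  by (induction I rule: infinite_finite_induct) (auto simp: absval_0 assms(1) absval_add_le_bound)

lemma absval_mult_le_one: "v x \<le> 1 \<Longrightarrow> v y \<le> 1 \<Longrightarrow> v (x * y) \<le> 1"
  by (simp add: absval_mult mult_le_one absval_nonneg)

lemma absval_power_le_one: "v x \<le> 1 \<Longrightarrow> v (x ^ n) \<le> 1"
  by (simp add: absval_power power_le_one absval_nonneg)

lemma absval_mult_le_right: "v x \<le> 1 \<Longrightarrow> v y \<le> r \<Longrightarrow> v (x * y) \<le> r"
  using mult_left_le_one_le[of "v y" "v x"] absval_nonneg[of x] absval_nonneg[of y]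
  by (simp add: absval_mult)

text \<open>All triangles are isosceles.\<close>
lemma absval_eq_of_diff_less: "v (x - y) < v y \<Longrightarrow> v x = v y"
  using absval_add_le[of "x - y" y] absval_diff_le[of x "x - y"] by simp

lemma absval_mult_diff_le:
  assumes "v a \<le> 1" "v b' \<le> 1" "v (a - a') \<le> r" "v (b - b') \<le> r"
  shows "v (a * b - a' * b') \<le> r"
proof -
  have "a * b - a' * b' = a * (b - b') + b' * (a - a')"
    by (simp add: algebra_simps)
  then show ?thesis
    using assms by (simp add: absval_add_le_bound absval_mult_le_right)
qed

lemma absval_power_diff_le:
  assumes "v a \<le> 1" "v a' \<le> 1" "v (a - a') \<le> r"
  shows "v (a ^ n - a' ^ n) \<le> r"
proof (induction n)
  case 0
  show ?case
    using absval_nonneg[of "a - a'"] assms by (simp add: absval_0)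
next
  case (Suc n)
  then show ?case
    using assms by (simp add: absval_mult_diff_le absval_power_le_one)
qed

lemma absval_form_eval_le_one:
  assumes "\<And>i. v (Polynomial.coeff p i) \<le> 1" "v x \<le> 1" "v y \<le> 1"
  shows "v (form_eval d p x y) \<le> 1"
  unfolding form_eval_def
  by (intro absval_sum_le absval_mult_le_one absval_power_le_one assms) auto

lemma absval_form_eval_diff_le:
  assumes "\<And>i. v (Polynomial.coeff p i) \<le> 1" "v x \<le> 1" "v y \<le> 1" "v x' \<le> 1" "v y' \<le> 1"
    "v (x - x') \<le> r" "v (y - y') \<le> r"
  shows "v (form_eval d p x y - form_eval d p x' y') \<le> r"
proof -
  have "0 \<le> r"
    using absval_nonneg[of "x - x'"] assms(6) by linarith
  then show ?thesis
    unfolding form_eval_def sum_subtractf[symmetric] right_diff_distrib[symmetric]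
    by (intro absval_sum_le absval_mult_le_right absval_mult_diff_le absval_power_diff_le
        absval_power_le_one assms)
qed

text \<open>
  The term of degree \<open>0\<close> in the first variable cancels, the term of degree \<open>1\<close> vanishes by
  hypothesis, and every other term is a multiple of \<open>x\<^sup>2\<close>.
\<close>
lemma absval_form_eval_diff_le_square:
  assumes "\<And>i. v (Polynomial.coeff p i) \<le> 1" "Polynomial.coeff p 1 = 0" "v x \<le> 1" "v y \<le> 1"
  shows "v (form_eval d p x y - form_eval d p 0 y) \<le> v x ^ 2"
  unfolding form_eval_def sum_subtractf[symmetric] right_diff_distrib[symmetric]
proof (rule absval_sum_le)
  fix i :: nat
  consider "i = 0" | "i = 1" | "2 \<le> i"
    by linarith
  then show "v (Polynomial.coeff p i * (x ^ i * y ^ (d - i) - 0 ^ i * y ^ (d - i))) \<le> v x ^ 2"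
  proof cases
    case 3
    then obtain j where j: "i = j + 2"
      by (auto simp: le_iff_add add.commute)
    have "v (x ^ j * (x ^ 2 * y ^ (d - i))) \<le> v x ^ 2"
      unfolding mult.commute[of "x ^ 2"] using assms
      by (intro absval_mult_le_right absval_power_le_one) (auto simp: absval_power)
    then show ?thesis
      using j assms by (intro absval_mult_le_right) (auto simp: power_add mult_ac power2_eq_square)
  qed (use assms in \<open>auto simp: absval_0\<close>)
qed simp

section \<open>Reduction\<close>

lemma ring_sel_valuation_ring:
  "carrier (valuation_ring v) = {x. v x \<le> 1}"
  "x \<otimes>\<^bsub>valuation_ring v\<^esub> y = x * y" "\<one>\<^bsub>valuation_ring v\<^esub> = 1"
  "x \<oplus>\<^bsub>valuation_ring v\<^esub> y = x + y" "\<zero>\<^bsub>valuation_ring v\<^esub> = 0"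
  by (simp_all add: valuation_ring_def restricted_ring_def ring_of_type_algebra_def)

lemma cring_valuation_ring: "cring (valuation_ring v)"
proof (rule cringI)
  show "abelian_group (valuation_ring v)"
  proof (rule abelian_groupI)
    fix x assume "x \<in> carrier (valuation_ring v)"
    then show "\<exists>y\<in>carrier (valuation_ring v). y \<oplus>\<^bsub>valuation_ring v\<^esub> x = \<zero>\<^bsub>valuation_ring v\<^esub>"
      by (intro bexI[of _ "- x"]) (auto simp: ring_sel_valuation_ring absval_minus)
  qed (auto simp: ring_sel_valuation_ring absval_add_le_bound absval_0)
  show "comm_monoid (valuation_ring v)"
    by (rule comm_monoidI) (auto simp: ring_sel_valuation_ring absval_mult_le_one absval_1)
qed (auto simp: ring_sel_valuation_ring algebra_simps)

lemma ideal_valuation_ideal: "ideal (valuation_ideal v) (valuation_ring v)"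
proof (rule idealI)
  interpret O: cring "valuation_ring v" by (rule cring_valuation_ring)
  show "ring (valuation_ring v)" by unfold_locales
  show "subgroup (valuation_ideal v) (add_monoid (valuation_ring v))"
  proof (rule group.subgroupI)
    show "group (add_monoid (valuation_ring v))" by (rule O.a_group)
    show "valuation_ideal v \<subseteq> carrier (add_monoid (valuation_ring v))"
      by (auto simp: valuation_ideal_def ring_sel_valuation_ring)
    show "valuation_ideal v \<noteq> {}"
      by (auto simp: valuation_ideal_def intro!: exI[of _ 0] simp: absval_0)
  next
    fix a assume a: "a \<in> valuation_ideal v"
    have "\<ominus>\<^bsub>valuation_ring v\<^esub> a = - a"
      using a by (intro O.minus_equality)
        (auto simp: ring_sel_valuation_ring valuation_ideal_def absval_minus)
    then show "inv\<^bsub>add_monoid (valuation_ring v)\<^esub> a \<in> valuation_ideal v"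
      using a by (simp add: a_inv_def valuation_ideal_def absval_minus)
  next
    fix a b assume "a \<in> valuation_ideal v" "b \<in> valuation_ideal v"
    then show "a \<otimes>\<^bsub>add_monoid (valuation_ring v)\<^esub> b \<in> valuation_ideal v"
      using absval_add_le[of a b] by (simp add: valuation_ideal_def ring_sel_valuation_ring)
  qed
  fix a x assume "a \<in> valuation_ideal v" "x \<in> carrier (valuation_ring v)"
  then have "v x * v a < 1"
    using mult_left_le_one_le[of "v a" "v x"] absval_nonneg[of x] absval_nonneg[of a]
    by (simp add: valuation_ideal_def ring_sel_valuation_ring)
  then show "x \<otimes>\<^bsub>valuation_ring v\<^esub> a \<in> valuation_ideal v"
    and "a \<otimes>\<^bsub>valuation_ring v\<^esub> x \<in> valuation_ideal v"
    by (simp_all add: valuation_ideal_def ring_sel_valuation_ring absval_mult mult.commute)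
qed

text \<open>An integral element outside the valuation ideal has absolute value \<open>1\<close>, hence is a unit.\<close>
lemma maximalideal_valuation_ideal: "maximalideal (valuation_ideal v) (valuation_ring v)"
proof (rule maximalidealI[OF ideal_valuation_ideal])
  show "carrier (valuation_ring v) \<noteq> valuation_ideal v"
    using absval_1 by (auto simp: ring_sel_valuation_ring valuation_ideal_def set_eq_iff intro!: exI[of _ 1])
next
  fix J assume J: "ideal J (valuation_ring v)" "valuation_ideal v \<subseteq> J" "J \<subseteq> carrier (valuation_ring v)"
  show "J = valuation_ideal v \<or> J = carrier (valuation_ring v)"
  proof (cases "J = valuation_ideal v")
    case False
    then obtain x where x: "x \<in> J" "v x = 1"
      using J by (force simp: valuation_ideal_def ring_sel_valuation_ring)
    then have "x \<noteq> 0"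
      using absval_0 by auto
    then have "v (inverse x) = 1"
      using absval_mult[of x "inverse x"] x(2) by (simp add: absval_1)
    then have "inverse x * x \<in> J"
      using ideal.I_l_closed[OF J(1) x(1), of "inverse x"] by (simp add: ring_sel_valuation_ring)
    then have "1 \<in> J"
      using \<open>x \<noteq> 0\<close> by simp
    then show ?thesis
      using ideal.one_imp_carrier[OF J(1)] by (simp add: ring_sel_valuation_ring)
  qed simp
qed

lemma field_residue_field: "field (residue_field v)"
  unfolding residue_field_def
  by (rule maximalideal.quotient_is_field[OF maximalideal_valuation_ideal cring_valuation_ring])

text \<open>
  Common roots of the reduced forms are sought in the algebraic closure of the residue field, so
  integral elements are reduced directly into that closure.
\<close>
definition closure_reduce :: "'a \<Rightarrow> ('a set list \<times> nat) multiset \<Rightarrow> 'a set"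
  where "closure_reduce x = ring.indexed_const (residue_field v) (reduce v x)"

lemma ring_hom_closure_reduce:
  "ring_hom_cring (valuation_ring v) (field.alg_closure (residue_field v)) closure_reduce"
proof -
  interpret k: field "residue_field v" by (rule field_residue_field)
  have "algebraic_closure (field.alg_closure (residue_field v))
      (ring.indexed_const (residue_field v) ` carrier (residue_field v))"
    by (rule k.alg_closureE(1))
  then interpret L: algebraic_closure "field.alg_closure (residue_field v)"
      "ring.indexed_const (residue_field v) ` carrier (residue_field v)" .
  have "reduce v \<in> ring_hom (valuation_ring v) (residue_field v)"
    using ideal.rcos_ring_hom[OF ideal_valuation_ideal]
    unfolding residue_field_def reduce_def[abs_def] .
  then have "ring.indexed_const (residue_field v) \<circ> reduce v \<in>
      ring_hom (valuation_ring v) (field.alg_closure (residue_field v))"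
    using k.alg_closureE(2) by (rule ring_hom_trans)
  also have "ring.indexed_const (residue_field v) \<circ> reduce v = closure_reduce"
    by (auto simp: closure_reduce_def)
  finally show ?thesis
    by (intro ring_hom_cringI ring_hom_ringI2 cring_valuation_ring cring.axioms(1) L.is_cring)
qed

lemma closure_reduce_eq_0_iff:
  assumes "v x \<le> 1"
  shows "closure_reduce x = \<zero>\<^bsub>field.alg_closure (residue_field v)\<^esub> \<longleftrightarrow> v x < 1"
proof -
  interpret k: field "residue_field v" by (rule field_residue_field)
  interpret I: ideal "valuation_ideal v" "valuation_ring v" by (rule ideal_valuation_ideal)
  interpret h: ring_hom_cring "valuation_ring v" "field.alg_closure (residue_field v)" closure_reduce
    by (rule ring_hom_closure_reduce)
  have "closure_reduce x = \<zero>\<^bsub>field.alg_closure (residue_field v)\<^esub> \<longleftrightarrow> closure_reduce x = closure_reduce 0"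
    using h.hom_zero by (simp add: ring_sel_valuation_ring)
  also have "\<dots> \<longleftrightarrow> reduce v x = reduce v 0"
    by (simp add: closure_reduce_def k.indexed_const_eq_iff)
  also have "reduce v 0 = valuation_ideal v"
    unfolding reduce_def by (rule I.a_rcos_const) (simp add: valuation_ideal_def absval_0)
  also have "reduce v x = valuation_ideal v \<longleftrightarrow> x \<in> valuation_ideal v"
    unfolding reduce_def using I.rcos_const_imp_mem I.a_rcos_const assms
    by (auto simp: ring_sel_valuation_ring)
  finally show ?thesis
    by (simp add: valuation_ideal_def)
qed

lemma valuation_ring_pow: "x [^]\<^bsub>valuation_ring v\<^esub> (n::nat) = x ^ n"
proof -
  interpret O: cring "valuation_ring v" by (rule cring_valuation_ring)
  show ?thesis
    by (induction n) (auto simp: ring_sel_valuation_ring mult.commute)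
qed

lemma valuation_ring_finsum:
  assumes "\<And>i. i \<in> I \<Longrightarrow> v (f i) \<le> 1"
  shows "finsum (valuation_ring v) f I = sum f I"
proof -
  interpret O: cring "valuation_ring v" by (rule cring_valuation_ring)
  show ?thesis using assms
    by (induction I rule: infinite_finite_induct) (auto simp: ring_sel_valuation_ring Pi_def)
qed

text \<open>Evaluating a form commutes with reduction, because reduction is a ring homomorphism.\<close>
lemma reduced_form_eval_closure_reduce:
  assumes "\<And>i. v (Polynomial.coeff P i) \<le> 1" "v x \<le> 1" "v y \<le> 1"
  shows "reduced_form_eval v d P (closure_reduce x) (closure_reduce y) =
    closure_reduce (form_eval d P x y)"
proof -
  interpret h: ring_hom_cring "valuation_ring v" "field.alg_closure (residue_field v)" closure_reduce
    by (rule ring_hom_closure_reduce)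
  let ?O = "valuation_ring v" and ?L = "field.alg_closure (residue_field v)"
  let ?t = "\<lambda>i. Polynomial.coeff P i * (x ^ i * y ^ (d - i))"
  have mem: "x \<in> carrier ?O" "y \<in> carrier ?O" "\<And>i. Polynomial.coeff P i \<in> carrier ?O"
    using assms by (auto simp: ring_sel_valuation_ring)
  have t: "v (?t i) \<le> 1" for i
    by (intro absval_mult_le_one absval_power_le_one assms)
  have term_eq: "closure_reduce (?t i) = closure_reduce (Polynomial.coeff P i)
        \<otimes>\<^bsub>?L\<^esub> (closure_reduce x [^]\<^bsub>?L\<^esub> i \<otimes>\<^bsub>?L\<^esub> closure_reduce y [^]\<^bsub>?L\<^esub> (d - i))" for i
  proof -
    have "?t i = Polynomial.coeff P i \<otimes>\<^bsub>?O\<^esub> (x [^]\<^bsub>?O\<^esub> i \<otimes>\<^bsub>?O\<^esub> y [^]\<^bsub>?O\<^esub> (d - i))"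
      by (simp add: ring_sel_valuation_ring valuation_ring_pow)
    then show ?thesis
      using mem by simp
  qed
  have "closure_reduce (form_eval d P x y) = closure_reduce (finsum ?O ?t {..d})"
    using t by (simp add: form_eval_def valuation_ring_finsum)
  also have "\<dots> = finsum ?L (closure_reduce \<circ> ?t) {..d}"
    using t by (intro h.hom_finsum) (auto simp: ring_sel_valuation_ring)
  also have "\<dots> = reduced_form_eval v d P (closure_reduce x) (closure_reduce y)"
    unfolding reduced_form_eval_def Let_def comp_def term_eq
    by (simp add: closure_reduce_def)
  finally show ?thesis ..
qed

text \<open>The integral vectors whose reduction is nonzero, and hence a point of the projective line.\<close>
definition primitive :: "'a \<times> 'a \<Rightarrow> bool"
  where "primitive z \<longleftrightarrow> max (v (fst z)) (v (snd z)) = 1"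

text \<open>
  The reduction of a primitive vector is a point of the projective line over the residue field; if
  its image were not primitive, this point would be a common root.
\<close>
lemma primitive_form_map_of_no_common_root:
  assumes "\<And>i. v (Polynomial.coeff P i) \<le> 1" "\<And>i. v (Polynomial.coeff Q i) \<le> 1"
    and "\<not> reductions_have_common_root v d P Q" and z: "primitive z"
  shows "primitive (form_map d P Q z)"
proof (rule ccontr)
  interpret h: ring_hom_cring "valuation_ring v" "field.alg_closure (residue_field v)" closure_reduce
    by (rule ring_hom_closure_reduce)
  let ?L = "field.alg_closure (residue_field v)"
  obtain x y where [simp]: "z = (x, y)" by (cases z)
  have xy: "v x \<le> 1" "v y \<le> 1" "\<not> (v x < 1 \<and> v y < 1)"
    using z by (auto simp: primitive_def max_def split: if_splits)
  have le: "v (form_eval d P x y) \<le> 1" "v (form_eval d Q x y) \<le> 1"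
    using assms xy by (auto intro: absval_form_eval_le_one)
  assume "\<not> primitive (form_map d P Q z)"
  then have "v (form_eval d P x y) < 1" "v (form_eval d Q x y) < 1"
    using le by (auto simp: primitive_def form_map_sel max_def split: if_splits)
  then have "reduced_form_eval v d P (closure_reduce x) (closure_reduce y) = \<zero>\<^bsub>?L\<^esub>"
      "reduced_form_eval v d Q (closure_reduce x) (closure_reduce y) = \<zero>\<^bsub>?L\<^esub>"
    using assms xy le by (simp_all add: reduced_form_eval_closure_reduce closure_reduce_eq_0_iff)
  moreover have "closure_reduce x \<in> carrier ?L" "closure_reduce y \<in> carrier ?L"
    using xy by (auto intro!: h.hom_closed simp: ring_sel_valuation_ring)
  moreover have "(closure_reduce x, closure_reduce y) \<noteq> (\<zero>\<^bsub>?L\<^esub>, \<zero>\<^bsub>?L\<^esub>)"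
    using xy by (simp add: closure_reduce_eq_0_iff)
  ultimately show False
    using assms(3) unfolding reductions_have_common_root_def Let_def by blast
qed

text \<open>
  The normalized pair that witnesses good reduction is a polynomial multiple of \<open>p, q\<close>. The
  degree bound makes the multiplier a constant, and as both pairs are normalized this constant has
  absolute value \<open>1\<close>, so \<open>F\<close> for one pair differs from \<open>F\<close> for the other by a unit factor.
\<close>
lemma primitive_form_map:
  fixes p q :: "'a poly"
  defines "d \<equiv> max (Polynomial.degree p) (Polynomial.degree q)"
  assumes "q \<noteq> 0" "coprime p q" "normalized_pair v p q"
    and "good_reduction v (Fraction_Field.Fract p q)" and z: "primitive z"
  shows "primitive (form_map d p q z)"
proof -
  have d: "rat_degree (Fraction_Field.Fract p q) = d"
    using rat_degree_eq assms by simp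
  obtain P Q where PQ: "Polynomial.degree P \<le> d" "Polynomial.degree Q \<le> d" "Q \<noteq> 0"
      "Fraction_Field.Fract p q = Fraction_Field.Fract P Q" "normalized_pair v P Q"
      "\<not> reductions_have_common_root v d P Q"
    using assms(5) unfolding good_reduction_def d by blast
  obtain h where h: "h \<noteq> 0" "P = p * h" "Q = q * h"
    using Fract_eq_lowest_terms[of q Q p P] assms PQ by metis
  have "d + Polynomial.degree h \<le> d"
    using max_degree_mult_right[of q h p] assms(2) h PQ(1,2) d_def by simp
  then obtain c where "h = [:c:]"
    by (metis add_le_same_cancel1 degree_eq_zeroE le_zero_eq)
  then have PQc: "P = Polynomial.smult c p" "Q = Polynomial.smult c q"
    using h by simp_all
  obtain i where i: "v (Polynomial.coeff p i) = 1 \<or> v (Polynomial.coeff q i) = 1"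
    using assms(4) by (auto simp: normalized_pair_def)
  have "v c * v (Polynomial.coeff p i) \<le> 1" "v c * v (Polynomial.coeff q i) \<le> 1"
    using PQ(5) by (auto simp: normalized_pair_def PQc simp flip: absval_mult)
  with i have "v c \<le> 1" by auto
  obtain j where j: "v c * v (Polynomial.coeff p j) = 1 \<or> v c * v (Polynomial.coeff q j) = 1"
    using PQ(5) by (auto simp: normalized_pair_def PQc simp flip: absval_mult)
  have "v (Polynomial.coeff p j) \<le> 1" "v (Polynomial.coeff q j) \<le> 1"
    using assms(4) by (auto simp: normalized_pair_def)
  with j have "1 \<le> v c"
    using absval_nonneg[of c] by (metis mult_left_le)
  with \<open>v c \<le> 1\<close> have c: "v c = 1" by simp
  have "primitive (form_map d P Q z)"
    using PQ(5,6) z by (intro primitive_form_map_of_no_common_root) (auto simp: normalized_pair_def)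
  then show ?thesis
    by (simp add: primitive_def form_map_sel PQc form_eval_smult absval_mult c)
qed

section \<open>Rigidity\<close>

text \<open>
  The congruence says that, up to a unit and an error quadratic in \<open>c n\<close>, the sequence starts over
  after a term that is small. The quadratic error is what preserves the exact absolute value in the
  first claim; for the second an error less than \<open>1\<close> is enough.
\<close>
lemma rigid_of_congruence:
  fixes c :: "nat \<Rightarrow> 'a"
  assumes congr: "\<And>m n. m \<ge> 1 \<Longrightarrow> n \<ge> 1 \<Longrightarrow> v (c n) < 1 \<Longrightarrow>
      \<exists>u. v u = 1 \<and> v (c (n + m) - u * c m) \<le> v (c n) ^ 2"
  shows "n \<ge> 1 \<Longrightarrow> v (c n) < 1 \<Longrightarrow> k \<ge> 1 \<Longrightarrow> v (c (k * n)) = v (c n)"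
    and "m \<ge> 1 \<Longrightarrow> n \<ge> 1 \<Longrightarrow> v (c m) < 1 \<Longrightarrow> v (c n) < 1 \<Longrightarrow> v (c (gcd m n)) < 1"
proof -
  assume n: "n \<ge> 1" "v (c n) < 1"
  assume "k \<ge> 1"
  then show "v (c (k * n)) = v (c n)"
  proof (induction k rule: dec_induct)
    case (step k)
    have "k * n \<ge> 1"
      using step n by simp
    then obtain u where u: "v u = 1" "v (c (n + k * n) - u * c (k * n)) \<le> v (c n) ^ 2"
      using congr[of "k * n" n] n by auto
    have uc: "v (u * c (k * n)) = v (c n)"
      using step u by (simp add: absval_mult)
    \<comment> \<open>A zero term makes the congruence an equality; otherwise the error is strictly smaller than
      \<open>v (c n)\<close>.\<close>
    show ?case
    proof (cases "v (c n) = 0")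
      case True
      then have "c (n + k * n) = u * c (k * n)"
        using u(2) absval_nonneg[of "c (n + k * n) - u * c (k * n)"] absval_eq_0_iff
        by (metis diff_eq_diff_eq diff_self order_antisym power_zero_numeral right_minus_eq)
      then show ?thesis
        using uc by simp
    next
      case False
      then have "v (c n) ^ 2 < v (c n)"
        using n absval_nonneg[of "c n"] by (simp add: power2_eq_square)
      then have "v (c (n + k * n)) = v (u * c (k * n))"
        using u(2) uc by (intro absval_eq_of_diff_less) simp
      then show ?thesis
        using uc by simp
    qed
  qed simp
next
  have descend: "v (c m) < 1" if small: "m \<ge> 1" "n \<ge> 1" "v (c n) < 1" "v (c (n + m)) < 1" for m n
  proof -
    obtain u where u: "v u = 1" "v (c (n + m) - u * c m) \<le> v (c n) ^ 2"
      using congr[of m n] small by blast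
    have "v (c n) ^ 2 < 1"
      using small absval_nonneg[of "c n"] by (simp add: power_less_one_iff)
    then have "v (u * c m) < 1"
      using absval_diff_le[of "c (n + m)" "c (n + m) - u * c m"] u(2) small(4) by simp
    then show ?thesis
      using u(1) by (simp add: absval_mult)
  qed
  show "m \<ge> 1 \<Longrightarrow> n \<ge> 1 \<Longrightarrow> v (c m) < 1 \<Longrightarrow> v (c n) < 1 \<Longrightarrow> v (c (gcd m n)) < 1"
  proof (induction "m + n" arbitrary: m n rule: less_induct)
    case less
    consider "m = n" | "m < n" | "n < m" by linarith
    then show ?case
    proof cases
      case 2
      then have "v (c (gcd m (n - m))) < 1"
        using less.prems by (intro less.hyps descend[of "n - m" m]) auto
      then show ?thesis
        using 2 by (metis gcd.commute gcd_diff1_nat less_imp_le)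
    next
      case 3
      then have "v (c (gcd (m - n) n)) < 1"
        using less.prems by (intro less.hyps descend[of "m - n" n]) auto
      then show ?thesis
        using 3 by (metis gcd_diff1_nat less_imp_le)
    qed (use less.prems in auto)
  qed
qed

text \<open>
  One application of the lift creates the quadratic error, the remaining ones do not increase it;
  therefore \<open>m \<ge> 1\<close>.
\<close>
lemma form_map_pow_diff_le_square:
  assumes "normalized_pair v p q" "Polynomial.coeff p 1 = 0" "Polynomial.coeff q 1 = 0"
    and xy: "v x \<le> 1" "v y \<le> 1" and "m \<ge> 1"
  shows "v (fst ((form_map d p q ^^ m) (x, y)) - fst ((form_map d p q ^^ m) (0, y))) \<le> v x ^ 2"
proof -
  let ?F = "form_map d p q"
  have int: "v (Polynomial.coeff p i) \<le> 1" "v (Polynomial.coeff q i) \<le> 1" for i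
    using assms(1) by (auto simp: normalized_pair_def)
  have F_int: "v (fst ((?F ^^ m) z)) \<le> 1 \<and> v (snd ((?F ^^ m) z)) \<le> 1"
    if "v (fst z) \<le> 1" "v (snd z) \<le> 1" for m z
    using that by (induction m) (auto simp: form_map_sel int absval_form_eval_le_one)
  have "v (fst ((?F ^^ m) (x, y)) - fst ((?F ^^ m) (0, y))) \<le> v x ^ 2 \<and>
      v (snd ((?F ^^ m) (x, y)) - snd ((?F ^^ m) (0, y))) \<le> v x ^ 2"
    using \<open>m \<ge> 1\<close>
  proof (induction m rule: dec_induct)
    case base
    then show ?case
      using assms(2,3) xy int by (simp add: form_map_sel absval_form_eval_diff_le_square)
  next
    case (step m)
    then show ?case
      using F_int[of "(x, y)" m] F_int[of "(0, y)" m] xy int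
      by (simp add: form_map_sel absval_form_eval_diff_le absval_0)
  qed
  then show ?thesis ..
qed

text \<open>
  The orbit is continued from \<open>(a n, b)\<close>, and the first coordinate is replaced by \<open>0\<close> at the cost
  of a quadratic error. By homogeneity the orbit of \<open>(0, b)\<close> is a rescaling of the orbit of
  \<open>(0, 1)\<close>; the factor \<open>u\<close> is a power of \<open>b\<close>, which has absolute value \<open>1\<close> as \<open>(a n, b)\<close> is
  primitive.
\<close>
lemma form_map_orbit_congruence:
  fixes p q :: "'a poly"
  defines "d \<equiv> max (Polynomial.degree p) (Polynomial.degree q)"
  defines "a \<equiv> \<lambda>n. fst ((form_map d p q ^^ n) (0, 1))"
  assumes "q \<noteq> 0" "coprime p q" and norm: "normalized_pair v p q"
    and "good_reduction v (Fraction_Field.Fract p q)"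
    and lin: "Polynomial.coeff p 1 = 0" "Polynomial.coeff q 1 = 0"
    and "m \<ge> 1" and small: "v (a n) < 1"
  shows "\<exists>u. v u = 1 \<and> v (a (n + m) - u * a m) \<le> v (a n) ^ 2"
proof -
  let ?F = "form_map d p q"
  define b where "b = snd ((?F ^^ n) (0, 1))"
  have "primitive ((?F ^^ n) (0, 1))"
  proof (induction n)
    case 0
    show ?case by (simp add: primitive_def absval_0 absval_1)
  next
    case (Suc n)
    then show ?case
      using primitive_form_map assms by simp
  qed
  then have b: "v b = 1"
    using small by (auto simp: primitive_def a_def b_def max_def split: if_splits)
  have "a (n + m) = fst ((?F ^^ m) (a n, b))"
    by (simp add: a_def b_def add.commute[of n] funpow_add)
  moreover have "fst ((?F ^^ m) (0, b)) = b ^ d ^ m * a m"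
    using form_map_pow_scale[where c = b and x = 0 and y = 1] by (simp add: a_def)
  moreover have "v (fst ((?F ^^ m) (a n, b)) - fst ((?F ^^ m) (0, b))) \<le> v (a n) ^ 2"
    using form_map_pow_diff_le_square[OF norm lin] small b \<open>m \<ge> 1\<close> by simp
  ultimately show ?thesis
    using b by (intro exI[of _ "b ^ d ^ m"]) (simp add: absval_power)
qed

end

theorem theorem1p3:
  fixes R :: "'a::field set"
    and A S :: "('a \<Rightarrow> real) set"
    and \<phi> :: "'a poly fract"
    and p q :: "'a poly"
  assumes "dedekind_domain R"
    and "is_fraction_field_of R"
    and "complete_absvals A"
    and "rat_degree \<phi> \<ge> 2"
    and "\<forall>i. Polynomial.coeff p i \<in> R"
    and "\<forall>i. Polynomial.coeff q i \<in> R"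
    and "q \<noteq> 0"
    and "coprime p q"
    and "\<phi> = Fraction_Field.Fract p q"
    and "S = {v \<in> A. \<not> good_reduction v \<phi> \<or> \<not> normalized_pair v p q}"
    and "poly (pderiv p) 0 = 0"
    and "poly (pderiv q) 0 = 0"
  shows "rigid_divisibility_seq A S (\<lambda>n. poly (iterate_num p q n) 0)"
proof -
  define d where "d = max (Polynomial.degree p) (Polynomial.degree q)"
  let ?c = "\<lambda>n. poly (iterate_num p q n) 0"
  have c: "?c n = fst ((form_map d p q ^^ n) (0, 1))" for n
    unfolding d_def iterate_num_def poly_iterate_pair[symmetric] by simp
  have lin: "Polynomial.coeff p 1 = 0" "Polynomial.coeff q 1 = 0"
    using assms(11,12) by (simp_all add: poly_0_coeff_0 coeff_pderiv)
  have congr: "\<exists>u. v u = 1 \<and> v (?c (n + m) - u * ?c m) \<le> v (?c n) ^ 2"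
    if "v \<in> A - S" "m \<ge> 1" "v (?c n) < 1" for v m n
  proof -
    have "nonarch_absval v" "good_reduction v (Fraction_Field.Fract p q)" "normalized_pair v p q"
      using that(1) assms(3,9,10) by (auto simp: complete_absvals_def)
    then show ?thesis
      using form_map_orbit_congruence[of v q p m n] assms(7,8) lin that unfolding c d_def by blast
  qed
  have nonarch: "nonarch_absval v" if "v \<in> A - S" for v
    using that assms(3) by (auto simp: complete_absvals_def)
  show ?thesis
    unfolding rigid_divisibility_seq_def
  proof (intro ballI conjI allI impI)
    fix v n k
    assume "v \<in> A - S" "1 \<le> (n::nat)" "v (?c n) < 1" "1 \<le> (k::nat)"
    then show "v (?c n) = v (?c (k * n))"
      using rigid_of_congruence(1)[of v ?c n k] congr nonarch by simp
  next
    fix v m n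
    assume "v \<in> A - S" "1 \<le> (m::nat)" "1 \<le> (n::nat)" "v (?c m) < 1" "v (?c n) < 1"
    then show "v (?c (gcd m n)) < 1"
      using rigid_of_congruence(2)[of v ?c m n] congr nonarch by simp
  qed
qed

end
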